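(* For every basic sequence $Q$, $\operatorname{windim}\left(\mathbb R\setminus\mathscr{DN}(Q)\right)=1/2$. Moreover, $\mathscr{DN}(Q)\setminus\mathscr{RN}_1(Q)$ is not an $\alpha$-winning set for any $\alpha\in(0,1)$.
   Context: A basic sequence is a sequence $Q=(q_n)_{n=1}^\infty$ of integers $q_n\ge 2$. The $Q$-Cantor series expansion of $x\in\mathbb R$ is the unique expansion $x=\lfloor x\rfloor+\sum_{n=1}^\infty \frac{E_n}{q_1q_2\cdots q_n}$ with $E_n\in\{0,1,\dots,q_n-1\}$ for $n\ge1$ and $E_n\ne q_n-1$ for infinitely many $n$. For a block (finite sequence) $B$ of non-negative integers, $N_n^Q(B,x)$ is the number of times $B$ occurs in the digit sequence $(E_1,E_2,\dots)$ of $x$ starting at a position no greater than $n$. $\mathscr{RN}_1(Q)$ is the set of real $x$ such that for all blocks $B_1,B_2$ of length $1$, $\lim_{n\to\infty} N_n^Q(B_1,x)/N_n^Q(B_2,x)=1$. With $T_{Q,n}(x)=\left(\prod_{j=1}^n q_j\right)x \pmod 1$, $\mathscr{DN}(Q)$ is the set of real $x$ such that $(T_{Q,n}(x))_{n=0}^\infty$ is uniformly distributed mod $1$. Schmidt's game: let $\alpha,\beta\in(0,1)$, $S\subseteq\mathbb R$, and let $\rho(I)$ denote the radius of a (bounded, nondegenerate) interval $I$. Bob first picks any closed interval $B_1$; Alice picks a closed interval $A_1\subset B_1$ with $\rho(A_1)=\alpha\rho(B_1)$; Bob picks a closed interval $B_2\subset A_1$ with $\rho(B_2)=\beta\rho(A_1)$;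 Alice picks a closed interval $A_2\subset B_2$ with $\rho(A_2)=\alpha\rho(B_2)$; and so on. $S$ is $(\alpha,\beta)$-winning if Alice can play so that $\bigcap_{n=1}^\infty B_n\subseteq S$; $S$ is $\alpha$-winning if it is $(\alpha,\beta)$-winning for all $0<\beta<1$. $\operatorname{windim} S$ is the supremum of all $\alpha\in(0,1)$ such that $S$ is $\alpha$-winning. *)

theory Defs
  imports "HOL-Analysis.Analysis"
begin

section \<open>Cantor series expansions\<close>

text \<open>Sequences \<open>q\<close> and \<open>E\<close> are indexed from 1; the value \<open>q 0\<close> is never used.\<close>

definition basic_sequence :: "(nat \<Rightarrow> nat) \<Rightarrow> bool" where
  "basic_sequence q \<longleftrightarrow> (\<forall>n\<ge>1. q n \<ge> 2)"

definition cantor_expansion :: "(nat \<Rightarrow> nat) \<Rightarrow> real \<Rightarrow> (nat \<Rightarrow> nat) \<Rightarrow> bool" where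
  "cantor_expansion q x E \<longleftrightarrow>
     (\<forall>n\<ge>1. E n \<in> {0..q n - 1}) \<and>
     infinite {n. n \<ge> 1 \<and> E n \<noteq> q n - 1} \<and>
     (\<lambda>n. real (E (Suc n)) / real (\<Prod>j=1..Suc n. q j)) sums (x - of_int \<lfloor>x\<rfloor>)"

text \<open>The unused value at index 0 is pinned to 0, so that the digit sequence is unique as a
  function; the description is proper by \<open>cantor_expansion_ex1\<close> below.\<close>

definition cantor_digits :: "(nat \<Rightarrow> nat) \<Rightarrow> real \<Rightarrow> nat \<Rightarrow> nat" where
  "cantor_digits q x = (THE E. E 0 = 0 \<and> cantor_expansion q x E)"

definition block_count :: "(nat \<Rightarrow> nat) \<Rightarrow> nat list \<Rightarrow> real \<Rightarrow> nat \<Rightarrow> nat" where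
  "block_count q B x n =
     card {i. 1 \<le> i \<and> i \<le> n \<and> (\<forall>j<length B. cantor_digits q x (i + j) = B ! j)}"

text \<open>Since \<open>a / 0 = 0\<close>, the limit can be 1 only if the denominators are eventually nonzero.\<close>

definition RN1 :: "(nat \<Rightarrow> nat) \<Rightarrow> real set" where
  "RN1 q = {x. \<forall>B1 B2. length B1 = 1 \<and> length B2 = 1 \<longrightarrow>
     (\<lambda>n. real (block_count q B1 x n) / real (block_count q B2 x n)) \<longlonglongrightarrow> 1}"


section \<open>Uniform distribution\<close>

definition uniformly_distributed_mod_1 :: "(nat \<Rightarrow> real) \<Rightarrow> bool" where
  "uniformly_distributed_mod_1 u \<longleftrightarrow>
     (\<forall>a b. 0 \<le> a \<and> a < b \<and> b \<le> 1 \<longrightarrow>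
        (\<lambda>N. real (card {n. n < N \<and> frac (u n) \<in> {a..<b}}) / real N) \<longlonglongrightarrow> b - a)"

definition cantor_map :: "(nat \<Rightarrow> nat) \<Rightarrow> nat \<Rightarrow> real \<Rightarrow> real" where
  "cantor_map q n x = frac (real (\<Prod>j=1..n. q j) * x)"

definition DN :: "(nat \<Rightarrow> nat) \<Rightarrow> real set" where
  "DN q = {x. uniformly_distributed_mod_1 (\<lambda>n. cantor_map q n x)}"


section \<open>Schmidt's game\<close>

text \<open>The closed interval \<open>{a..b}\<close> is represented by the pair \<open>(a, b)\<close>. Alice's strategy maps the
  list \<open>[B\<^sub>1, \<dots>, B\<^sub>n]\<close> of Bob's moves so far to her reply \<open>A\<^sub>n\<close>. Bob's moves form a sequence indexed
  from 0, so \<open>B n\<close> is his move number \<open>n + 1\<close>.\<close>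

type_synonym ivl = "real \<times> real"

definition ivl_set :: "ivl \<Rightarrow> real set" where
  "ivl_set I = {fst I..snd I}"

definition radius :: "ivl \<Rightarrow> real" where
  "radius I = (snd I - fst I) / 2"

definition legal_move :: "real \<Rightarrow> ivl \<Rightarrow> ivl \<Rightarrow> bool" where
  "legal_move \<gamma> I J \<longleftrightarrow> ivl_set J \<subseteq> ivl_set I \<and> radius J = \<gamma> * radius I"

definition reply :: "(ivl list \<Rightarrow> ivl) \<Rightarrow> (nat \<Rightarrow> ivl) \<Rightarrow> nat \<Rightarrow> ivl" where
  "reply \<sigma> B n = \<sigma> (map B [0..<Suc n])"

definition bob_legal_upto :: "real \<Rightarrow> (ivl list \<Rightarrow> ivl) \<Rightarrow> (nat \<Rightarrow> ivl) \<Rightarrow> nat \<Rightarrow> bool" where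
  "bob_legal_upto \<beta> \<sigma> B n \<longleftrightarrow>
     radius (B 0) > 0 \<and> (\<forall>i<n. legal_move \<beta> (reply \<sigma> B i) (B (Suc i)))"

text \<open>Alice has to reply legally after every legal finite sequence of moves of Bob; demanding this
  for infinite plays only would let her win by blocking Bob with an illegal move.\<close>

definition winning_strategy ::
    "real \<Rightarrow> real \<Rightarrow> real set \<Rightarrow> (ivl list \<Rightarrow> ivl) \<Rightarrow> bool" where
  "winning_strategy \<alpha> \<beta> S \<sigma> \<longleftrightarrow>
     (\<forall>B. (\<forall>n. bob_legal_upto \<beta> \<sigma> B n \<longrightarrow> legal_move \<alpha> (B n) (reply \<sigma> B n)) \<and>
          ((\<forall>n. bob_legal_upto \<beta> \<sigma> B n) \<longrightarrow> (\<Inter>n. ivl_set (B n)) \<subseteq> S))"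

definition winning2 :: "real \<Rightarrow> real \<Rightarrow> real set \<Rightarrow> bool" where
  "winning2 \<alpha> \<beta> S \<longleftrightarrow> (\<exists>\<sigma>. winning_strategy \<alpha> \<beta> S \<sigma>)"

definition winning :: "real \<Rightarrow> real set \<Rightarrow> bool" where
  "winning \<alpha> S \<longleftrightarrow> (\<forall>\<beta>. 0 < \<beta> \<and> \<beta> < 1 \<longrightarrow> winning2 \<alpha> \<beta> S)"

text \<open>Inserting 0 makes the supremum of the empty set equal to 0 and changes nothing otherwise.\<close>

definition windim :: "real set \<Rightarrow> real" where
  "windim S = Sup (insert 0 {\<alpha>. 0 < \<alpha> \<and> \<alpha> < 1 \<and> winning \<alpha> S})"


section \<open>Existence and uniqueness of the Cantor series expansion\<close>

context
  fixes q :: "nat \<Rightarrow> nat" and P :: "nat \<Rightarrow> real"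
  assumes q: "basic_sequence q"
  defines "P \<equiv> \<lambda>n. real (\<Prod>j=1..n. q j)"
begin

lemma q_ge2: "real (q (Suc n)) \<ge> 2"
proof -
  have "q (Suc n) \<ge> 2" using q by (simp add: basic_sequence_def)
  then show ?thesis by linarith
qed

lemma P_0: "P 0 = 1" by (simp add: P_def)

lemma P_Suc: "P (Suc n) = real (q (Suc n)) * P n"
  by (simp add: P_def atLeastAtMostSuc_conv)

lemma P_ge: "P n \<ge> 2 ^ n"
proof (induction n)
  case (Suc n)
  have "2 * 2 ^ n \<le> real (q (Suc n)) * P n"
    by (rule mult_mono[OF q_ge2 Suc.IH]) auto
  then show ?case by (simp add: P_Suc)
qed (simp add: P_0)

lemma P_pos: "P n > 0"
  using P_ge[of n] by (smt (verit) zero_less_power)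

lemma inverse_P_tendsto: "(\<lambda>n. 1 / P n) \<longlonglongrightarrow> 0"
proof (rule tendsto_sandwich[of "\<lambda>_. 0" _ _ "\<lambda>n. (1/2) ^ n"])
  show "\<forall>\<^sub>F n in sequentially. 0 \<le> 1 / P n"
    using P_pos by (simp add: less_imp_le)
  show "\<forall>\<^sub>F n in sequentially. 1 / P n \<le> (1/2) ^ n"
    using P_ge P_pos by (intro always_eventually allI) (simp add: power_one_over frac_le)
qed (auto intro: LIMSEQ_realpow_zero)

lemma cantor_expansion_floor:
  assumes E: "cantor_expansion q x E"
  shows "int (E (Suc n)) = \<lfloor>P (Suc n) * frac x\<rfloor> - int (q (Suc n)) * \<lfloor>P n * frac x\<rfloor>"
proof -
  define S where "S n = (\<Sum>k<n. real (E (Suc k)) / P (Suc k))" for n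
  define D :: "nat \<Rightarrow> int" where
    "D = rec_nat 0 (\<lambda>n d. int (q (Suc n)) * d + int (E (Suc n)))"
  have D_Suc: "D (Suc n) = int (q (Suc n)) * D n + int (E (Suc n))" for n
    by (simp add: D_def)
  have S_Suc: "S (Suc n) = S n + real (E (Suc n)) / P (Suc n)" for n
    by (simp add: S_def)
  have PS: "P n * S n = of_int (D n)" for n
  proof (induction n)
    case 0 then show ?case by (simp add: S_def D_def)
  next
    case (Suc n)
    have "P (Suc n) * S (Suc n) = real (q (Suc n)) * (P n * S n) + real (E (Suc n))"
      using P_pos[of n] q_ge2[of n] by (simp add: S_Suc P_Suc distrib_left)
    then show ?case by (simp add: Suc D_Suc)
  qed
  have lim: "S \<longlonglongrightarrow> frac x"
    using E unfolding cantor_expansion_def sums_def S_def P_def frac_def by simp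
  have "incseq S"
    by (rule incseq_SucI) (use P_pos in \<open>simp add: S_Suc less_imp_le\<close>)
  then have lower: "S n \<le> frac x" for n using lim by (rule incseq_le)
  define U where "U n = S n + 1 / P n" for n
  have U_Suc: "U (Suc n) = U n - (real (q (Suc n)) - 1 - real (E (Suc n))) / P (Suc n)" for n
  proof -
    have "1 / P n = real (q (Suc n)) / P (Suc n)"
      using q_ge2[of n] P_pos[of n] by (simp add: P_Suc)
    then show ?thesis by (simp add: U_def S_Suc diff_divide_distrib)
  qed
  have E_le: "real (E (Suc n)) \<le> real (q (Suc n)) - 1" for n
  proof -
    have "E (Suc n) \<le> q (Suc n) - 1" using E by (simp add: cantor_expansion_def)
    then show ?thesis using q_ge2[of n] by linarith
  qed
  have decU: "decseq U"
    by (rule decseq_SucI) (use P_pos E_le in \<open>simp add: U_Suc less_imp_le\<close>)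
  have "U \<longlonglongrightarrow> frac x + 0"
    unfolding U_def by (intro tendsto_add lim inverse_P_tendsto)
  then have leU: "frac x \<le> U n" for n using decU by (intro decseq_ge[of U]) auto
  have upper: "frac x < U n" for n
  proof -
    obtain m where m: "m > n" "E m \<noteq> q m - 1"
      using E unfolding cantor_expansion_def infinite_nat_iff_unbounded by blast
    then obtain k where k: "m = Suc k" "n \<le> k" by (cases m) auto
    have "E (Suc k) \<noteq> q (Suc k) - 1" using m k by simp
    then have "real (E (Suc k)) < real (q (Suc k)) - 1"
      using E_le[of k] q_ge2[of k] by linarith
    then have "U (Suc k) < U k" using P_pos[of "Suc k"] by (simp add: U_Suc)
    also have "U k \<le> U n" using decU k by (simp add: decseqD)
    finally show ?thesis using leU[of "Suc k"] by simp
  qed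
  have fl: "\<lfloor>P n * frac x\<rfloor> = D n" for n
  proof (rule floor_unique)
    show "of_int (D n) \<le> P n * frac x"
      using lower[of n] P_pos[of n] by (simp flip: PS)
    have "P n * frac x < P n * U n" using upper[of n] P_pos[of n] by simp
    also have "\<dots> = of_int (D n) + 1" using P_pos[of n] by (simp add: U_def distrib_left PS)
    finally show "P n * frac x < of_int (D n) + 1" .
  qed
  show ?thesis by (simp add: fl D_Suc)
qed

lemma cantor_expansion_exists: "\<exists>E. E 0 = 0 \<and> cantor_expansion q x E"
proof -
  define f where "f = frac x"
  have f: "0 \<le> f" "f < 1" by (auto simp: f_def frac_lt_1)
  define D where "D n = \<lfloor>P n * f\<rfloor>" for n
  have D_le: "of_int (D n) \<le> P n * f" and D_gt: "P n * f < of_int (D n) + 1" for n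
    unfolding D_def by linarith+
  define e where "e n = D (Suc n) - int (q (Suc n)) * D n" for n
  define E where "E n = (case n of 0 \<Rightarrow> 0 | Suc k \<Rightarrow> nat (e k))" for n
  have e_eq: "e n = \<lfloor>real (q (Suc n)) * (P n * f - of_int (D n))\<rfloor>" for n
  proof -
    have "real (q (Suc n)) * (P n * f - of_int (D n)) =
        P (Suc n) * f - of_int (int (q (Suc n)) * D n)"
      by (simp add: P_Suc right_diff_distrib)
    then show ?thesis
      unfolding e_def D_def[of "Suc n"] by (simp only: floor_diff_of_int)
  qed
  have e0: "e n \<ge> 0" for n
    unfolding e_eq using D_le[of n] by simp
  have e1: "e n < int (q (Suc n))" for n
  proof -
    have "real (q (Suc n)) * (P n * f - of_int (D n)) < real (q (Suc n)) * 1"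
      by (rule mult_strict_left_mono) (use D_gt[of n] q_ge2[of n] in auto)
    then show ?thesis unfolding e_eq by (simp add: floor_less_iff)
  qed
  have E_Suc: "real (E (Suc n)) = of_int (e n)" for n using e0[of n] by (simp add: E_def)
  have sum: "(\<Sum>k<n. real (E (Suc k)) / P (Suc k)) = of_int (D n) / P n" for n
  proof (induction n)
    case 0
    have "D 0 = 0" using f by (simp add: D_def P_0 floor_eq_iff)
    then show ?case by simp
  next
    case (Suc n)
    have "of_int (D n) / P n = real (q (Suc n)) * of_int (D n) / P (Suc n)"
      using q_ge2[of n] by (simp add: P_Suc)
    then have "(\<Sum>k<Suc n. real (E (Suc k)) / P (Suc k)) =
        real (q (Suc n)) * of_int (D n) / P (Suc n) + of_int (e n) / P (Suc n)"
      using Suc by (simp add: E_Suc)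
    then show ?case by (simp add: e_def flip: add_divide_distrib)
  qed
  have "(\<lambda>n. of_int (D n) / P n) \<longlonglongrightarrow> f"
  proof (rule tendsto_sandwich[of "\<lambda>n. f - 1 / P n" _ _ "\<lambda>_. f"])
    show "\<forall>\<^sub>F n in sequentially. f - 1 / P n \<le> of_int (D n) / P n"
      using D_gt P_pos by (intro always_eventually allI)
        (smt (verit, best) add_divide_distrib divide_right_mono nonzero_mult_div_cancel_left)
    show "\<forall>\<^sub>F n in sequentially. of_int (D n) / P n \<le> f"
      using D_le P_pos by (intro always_eventually allI) (simp add: divide_le_eq mult.commute)
    show "(\<lambda>n. f - 1 / P n) \<longlonglongrightarrow> f"
      using tendsto_diff[OF tendsto_const inverse_P_tendsto, of f] by simp
  qed auto
  then have sums: "(\<lambda>n. real (E (Suc n)) / P (Suc n)) sums f"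
    by (simp add: sums_def sum)
  have inf: "infinite {n. n \<ge> 1 \<and> E n \<noteq> q n - 1}"
  proof
    assume "finite {n. n \<ge> 1 \<and> E n \<noteq> q n - 1}"
    then obtain m where m: "\<And>n. n \<ge> 1 \<Longrightarrow> E n \<noteq> q n - 1 \<Longrightarrow> n \<le> m"
      unfolding finite_nat_set_iff_bounded_le by blast
    define c where "c n = of_int (D n + 1) / P n" for n
    have "c (Suc n) = c n" if "n \<ge> m" for n
    proof -
      have "E (Suc n) = q (Suc n) - 1" using m[of "Suc n"] that by force
      then have "e n = int (q (Suc n)) - 1" using E_Suc[of n] q_ge2[of n] by linarith
      then have "D (Suc n) + 1 = int (q (Suc n)) * (D n + 1)"
        by (simp add: e_def algebra_simps)
      then have "of_int (D (Suc n) + 1) = real (q (Suc n)) * of_int (D n + 1)"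
        by (metis of_int_mult of_int_of_nat_eq)
      then show ?thesis using q_ge2[of n] by (simp add: c_def P_Suc)
    qed
    then have const: "c (m + n) = c m" for n by (induction n) auto
    have "c \<longlonglongrightarrow> f + 0"
      using tendsto_add[OF \<open>(\<lambda>n. of_int (D n) / P n) \<longlonglongrightarrow> f\<close> inverse_P_tendsto]
      by (simp add: c_def[abs_def] add_divide_distrib)
    then have "(\<lambda>n. c (n + m)) \<longlonglongrightarrow> f" by (intro LIMSEQ_ignore_initial_segment) simp
    then have "(\<lambda>n. c m) \<longlonglongrightarrow> f" using const by (simp add: add.commute)
    then have "c m = f" by (simp only: LIMSEQ_const_iff)
    then have "P m * f = of_int (D m + 1)"
      using P_pos[of m] by (auto simp: c_def)
    then show False using D_gt[of m] by simp
  qed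
  have "E n \<le> q n - 1" if n: "n \<ge> 1" for n
  proof -
    obtain k where "n = Suc k" using n by (cases n) auto
    then show ?thesis using e0[of k] e1[of k] by (simp add: E_def)
  qed
  then have "cantor_expansion q x E"
    using inf sums unfolding cantor_expansion_def P_def f_def frac_def by simp
  moreover have "E 0 = 0" by (simp add: E_def)
  ultimately show ?thesis by blast
qed

end

lemma cantor_expansion_ex1:
  assumes "basic_sequence q"
  shows "\<exists>!E. E 0 = 0 \<and> cantor_expansion q x E"
proof (rule ex_ex1I)
  show "\<exists>E. E 0 = 0 \<and> cantor_expansion q x E"
    using assms by (rule cantor_expansion_exists)
  fix E E' assume E: "E 0 = 0 \<and> cantor_expansion q x E" "E' 0 = 0 \<and> cantor_expansion q x E'"
  show "E = E'"
  proof
    fix n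
    show "E n = E' n"
    proof (cases n)
      case (Suc k)
      have "int (E (Suc k)) = int (E' (Suc k))"
        using cantor_expansion_floor[OF assms] E by metis
      then show ?thesis using Suc by simp
    qed (use E in simp)
  qed
qed

end

theory Submission
  imports Defs "HOL-Library.Discrete_Functions"
begin

text \<open>
  Write \<open>P\<^sub>n = q\<^sub>1 \<cdots> q\<^sub>n\<close>. A player whose moves shrink by a ratio \<open>\<gamma> < 1/2\<close> can steer away from
  \<open>DN q\<close>: in an interval of radius \<open>\<rho>\<close> let \<open>m\<close> be maximal with \<open>4 \<rho> P\<^sub>m \<le> 1\<close>. At most one multiple of
  \<open>1/P\<^sub>m\<close> is near the interval, and moving to the left or to the right end keeps every later point at
  distance at least \<open>(1 - 2\<gamma>) \<rho>\<close> from all multiples of \<open>1/P\<^sub>m\<close>. As \<open>P\<^sub>n\<close> divides \<open>P\<^sub>m\<close> for \<open>n \<le> m\<close>,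
  the multiples of \<open>1/P\<^sub>n\<close> are avoided as well, so \<open>frac (P\<^sub>n x)\<close> stays away from \<open>0\<close> for all large \<open>n\<close>.
  Alice does this if \<open>\<alpha> < 1/2\<close>; Bob does it with \<open>\<beta> = 1/4\<close> and thereby defeats every subset of
  \<open>DN q\<close>.

  If \<open>\<alpha> > 1/2\<close> and \<open>\<beta>\<close> is small, Bob can centre all of his intervals at any prescribed point, so an
  \<open>\<alpha>\<close>-winning set is all of \<open>\<real>\<close>. It remains to see that \<open>DN q\<close> is nonempty: the functions
  \<open>x \<mapsto> 1[frac (P\<^sub>n x) < b] - b\<close> on \<open>[0,1]\<close> have correlations at most \<open>2\<^bsup>-|n-m|\<^esup>\<close>, hence
  their sums have variance \<open>O(N)\<close> and their averages tend to \<open>0\<close> almost everywhere, first along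
  squares and then along all \<open>N\<close>.
\<close>

section \<open>Points with a uniformly distributed orbit\<close>

definition cantor_base :: "(nat \<Rightarrow> nat) \<Rightarrow> nat \<Rightarrow> nat" where
  "cantor_base q n = (\<Prod>j=1..n. q j)"

lemma cantor_base_dvd: "m \<le> n \<Longrightarrow> cantor_base q m dvd cantor_base q n"
  unfolding cantor_base_def by (rule prod_dvd_prod_subset) auto

lemma cantor_base_ge:
  assumes "basic_sequence q"
  shows "2 ^ k * cantor_base q m \<le> cantor_base q (m + k)"
proof (induction k)
  case (Suc k)
  have "2 \<le> q (Suc (m + k))" using assms by (simp add: basic_sequence_def)
  then have "2 * (2 ^ k * cantor_base q m) \<le> q (Suc (m + k)) * cantor_base q (m + k)"
    using Suc by (rule mult_le_mono)
  then show ?case by (simp add: cantor_base_def atLeastAtMostSuc_conv mult.assoc)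
qed simp

lemma cantor_base_ge_power: "basic_sequence q \<Longrightarrow> 2 ^ n \<le> cantor_base q n"
  using cantor_base_ge[of q n 0] by (simp add: cantor_base_def)

lemma cantor_base_pos: "basic_sequence q \<Longrightarrow> cantor_base q n > 0"
  using cantor_base_ge_power[of q n] by (metis less_le_trans pos2 zero_less_power)

lemma DN_iff:
  "x \<in> DN q \<longleftrightarrow> uniformly_distributed_mod_1 (\<lambda>n. real (cantor_base q n) * x)"
  by (simp add: DN_def uniformly_distributed_mod_1_def cantor_map_def cantor_base_def)

text \<open>Serves twice: it makes a largest scale \<open>P\<^sub>m\<close> available to a player,
  and it bounds the number of orbit points for which nothing is known.\<close>

lemma finite_cantor_base_le:
  assumes q: "basic_sequence q" and r: "r > 0"
  shows "finite {n. r * real (cantor_base q n) \<le> 1}"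
proof -
  obtain N where N: "1 / r < 2 ^ N" using real_arch_pow[of 2 "1 / r"] by auto
  have "n < N" if n: "r * real (cantor_base q n) \<le> 1" for n
  proof (rule ccontr)
    assume "\<not> n < N"
    then have "(2::real) ^ N \<le> 2 ^ n" by simp
    also have "\<dots> \<le> real (cantor_base q n)"
      using cantor_base_ge_power[OF q, of n] by (metis of_nat_le_iff of_nat_numeral of_nat_power)
    finally have "1 / r < real (cantor_base q n)" using N by linarith
    then show False using n r by (simp add: field_simps)
  qed
  then show ?thesis by (meson bounded_nat_set_is_finite mem_Collect_eq)
qed

section \<open>The centred indicator of an interval and its periodic primitive\<close>

definition interval_dev :: "real \<Rightarrow> real \<Rightarrow> real" where
  "interval_dev b t = (if frac t < b then 1 else 0) - b"

text \<open>For \<open>0 \<le> b \<le> 1\<close> this is the continuous 1-periodic primitive of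
  \<open>interval_dev b\<close> that vanishes at the integers: slope \<open>1 - b\<close> up to
  \<open>b\<close>, then slope \<open>-b\<close>. The two lines cross at \<open>b\<close>, so a
  minimum replaces the case distinction.\<close>

definition tent :: "real \<Rightarrow> real \<Rightarrow> real" where
  "tent b t = min ((1 - b) * frac t) (b * (1 - frac t))"

lemma tent_of_int [simp]: "0 \<le> b \<Longrightarrow> tent b (of_int k) = 0"
  by (simp add: tent_def)

lemma tent_of_int_add [simp]: "tent b (of_int k + t) = tent b t"
  by (simp add: tent_def)

lemma tent_nonneg: "0 \<le> b \<Longrightarrow> b \<le> 1 \<Longrightarrow> 0 \<le> tent b t"
  using frac_lt_1[of t] by (simp add: tent_def less_imp_le)

lemma tent_le_1: "0 \<le> b \<Longrightarrow> b \<le> 1 \<Longrightarrow> tent b t \<le> 1"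
  using frac_lt_1[of t] mult_le_one[of "1 - b" "frac t"] by (simp add: tent_def min_le_iff_disj)

text \<open>Both slopes are at most 1 in absolute value. The bound yields continuity at the
  integers, where \<open>frac\<close> jumps.\<close>

lemma tent_le_dist_int:
  assumes b: "0 \<le> b" "b \<le> 1"
  shows "tent b t \<le> \<bar>t - of_int k\<bar>"
proof (cases "of_int k \<le> t")
  case True
  then have "k \<le> \<lfloor>t\<rfloor>" by (simp add: le_floor_iff)
  then have "frac t \<le> t - of_int k" by (simp add: frac_def)
  moreover have "(1 - b) * frac t \<le> frac t" using b by (simp add: mult_left_le_one_le)
  ultimately show ?thesis unfolding tent_def by linarith
next
  case False
  then have "\<lfloor>t\<rfloor> < k" by (simp add: floor_less_iff)
  then have "1 - frac t \<le> of_int k - t" by (simp add: frac_def)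
  moreover have "b * (1 - frac t) \<le> 1 - frac t"
    using b frac_lt_1[of t] by (simp add: mult_left_le_one_le)
  ultimately show ?thesis unfolding tent_def by linarith
qed

lemma isCont_tent:
  assumes b: "0 \<le> b" "b \<le> 1"
  shows "isCont (tent b) t"
proof (cases "t \<in> \<int>")
  case True
  then obtain k where k: "t = of_int k" by (elim Ints_cases)
  have "(tent b \<longlongrightarrow> 0) (at t)"
  proof (rule tendsto_sandwich[of "\<lambda>_. 0" _ _ "\<lambda>s. \<bar>s - t\<bar>"])
    show "((\<lambda>s. \<bar>s - t\<bar>) \<longlongrightarrow> 0) (at t)" by (auto intro!: tendsto_eq_intros)
  qed (use b tent_nonneg tent_le_dist_int[of b _ k] k in auto)
  then show ?thesis using b k by (simp add: isCont_def)
next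
  case False
  then have "isCont frac t" by (rule continuous_frac)
  then show ?thesis unfolding tent_def by (intro continuous_intros)
qed

text \<open>The corners lie at the integers and their translates by \<open>b\<close>; between
  neighbouring corners the function is affine.\<close>

lemma tent_has_vector_derivative:
  assumes b: "0 \<le> b" "b \<le> 1" and t: "t \<notin> \<int>" "t - b \<notin> \<int>"
  shows "(tent b has_vector_derivative interval_dev b t) (at t)"
proof -
  define k where "k = \<lfloor>t\<rfloor>"
  have "of_int k \<noteq> t" using t by auto
  then have k: "of_int k < t" "t < of_int k + 1" unfolding k_def by linarith+
  have fr: "frac s = s - of_int k" if "of_int k < s" "s < of_int k + 1" for s
  proof -
    have "\<lfloor>s\<rfloor> = k" using that by (intro floor_unique) auto
    then show ?thesis by (simp add: frac_def)
  qed
  have "t - b \<noteq> of_int k" using t by auto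
  then consider "t < of_int k + b" | "of_int k + b < t" by linarith
  then show ?thesis
  proof cases
    case 1
    show ?thesis
    proof (rule has_vector_derivative_transform_within_open[of "\<lambda>s. (1 - b) * (s - of_int k)" _ _ "{of_int k<..<of_int k + b}"])
      show "((\<lambda>s. (1 - b) * (s - of_int k)) has_vector_derivative interval_dev b t) (at t)"
        using 1 k by (auto simp: interval_dev_def fr intro!: derivative_eq_intros)
      show "(1 - b) * (s - of_int k) = tent b s" if "s \<in> {of_int k<..<of_int k + b}" for s
        using that b by (simp add: tent_def fr algebra_simps)
    qed (use 1 k in auto)
  next
    case 2
    show ?thesis
    proof (rule has_vector_derivative_transform_within_open[of "\<lambda>s. b * (1 - (s - of_int k))" _ _ "{of_int k + b<..<of_int k + 1}"])
      show "((\<lambda>s. b * (1 - (s - of_int k))) has_vector_derivative interval_dev b t) (at t)"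
        using 2 k by (auto simp: interval_dev_def fr intro!: derivative_eq_intros)
      show "b * (1 - (s - of_int k)) = tent b s" if "s \<in> {of_int k + b<..<of_int k + 1}" for s
        using that b by (simp add: tent_def fr algebra_simps)
    qed (use 2 k in auto)
  qed
qed

lemma finite_Ints_shift: "finite {t \<in> {u..v::real}. t - c \<in> \<int>}"
proof (rule finite_subset)
  show "{t \<in> {u..v}. t - c \<in> \<int>} \<subseteq> (\<lambda>k. of_int k + c) ` {\<lfloor>u - c\<rfloor>..\<lceil>v - c\<rceil>}"
  proof
    fix t assume t: "t \<in> {t \<in> {u..v}. t - c \<in> \<int>}"
    then obtain k where k: "t - c = of_int k" by (auto elim: Ints_cases)
    then have "k \<in> {\<lfloor>u - c\<rfloor>..\<lceil>v - c\<rceil>}" using t by (auto simp: floor_le_iff le_ceiling_iff)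
    moreover have "t = of_int k + c" using k by simp
    ultimately show "t \<in> (\<lambda>k. of_int k + c) ` {\<lfloor>u - c\<rfloor>..\<lceil>v - c\<rceil>}" by blast
  qed
qed simp

text \<open>The fundamental theorem tolerates finitely many corners because \<open>tent b\<close> is
  continuous; the factor \<open>r\<close> enters by the substitution
  \<open>t = r * x\<close>.\<close>

lemma has_integral_interval_dev:
  assumes b: "0 \<le> b" "b \<le> 1" and uv: "u \<le> v" and r: "r > 0"
  shows "((\<lambda>x. interval_dev b (r * x)) has_integral (tent b (r * v) - tent b (r * u)) / r) {u..v}"
proof -
  have "(interval_dev b has_integral tent b (r * v) - tent b (r * u)) {r * u..r * v}"
  proof (rule fundamental_theorem_of_calculus_strong)
    show "finite ({t \<in> {r * u..r * v}. t - 0 \<in> \<int>} \<union> {t \<in> {r * u..r * v}. t - b \<in> \<int>})"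
      by (intro finite_UnI finite_Ints_shift)
    show "continuous_on {r * u..r * v} (tent b)"
      using isCont_tent[OF b] by (auto intro: continuous_at_imp_continuous_on)
  qed (use uv r tent_has_vector_derivative[OF b] in auto)
  then have "(interval_dev b has_integral tent b (r * v) - tent b (r * u)) (cbox (r * u) (r * v))"
    by simp
  from has_integral_affinity'[OF this r, of 0] show ?thesis
    using r by (simp add: divide_inverse_commute flip: mult.assoc)
qed

text \<open>Where \<open>P x\<close> runs through one period, the first factor is constant on two pieces, so the
  integral of the product is a combination of values of \<open>tent b\<close>.\<close>

lemma has_integral_interval_dev_correlation:
  assumes b: "0 \<le> b" "b \<le> 1" and P: "P > 0" and M: "M > 0"
  shows "((\<lambda>x. interval_dev b (real P * x) * interval_dev b (real (M * P) * x))
      has_integral tent b (real M * b) / real M) {0..1}"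
proof -
  define p where "p = real P"
  define f where "f x = interval_dev b (p * x)" for x
  define g where "g x = interval_dev b (real M * p * x)" for x
  define c where "c = tent b (real M * b) / (real M * p)"
  have p: "p > 0" and M0: "real M > 0" using P M by (auto simp: p_def)
  have int_g: "(g has_integral (tent b (real M * p * v) - tent b (real M * p * u)) / (real M * p)) {u..v}"
    if "u \<le> v" for u v
    unfolding g_def using has_integral_interval_dev[OF b that, of "real M * p"] p M0 by simp
  \<comment> \<open>At \<open>j / p\<close> the argument is the integer \<open>M * j\<close>, so
    these endpoints contribute nothing; at \<open>(j + b) / p\<close> the contribution does not
    depend on \<open>j\<close>.\<close>
  have tent_j: "tent b (real M * p * (real j / p)) = 0" for j
    using p b tent_of_int[of b "int (M * j)"] by simp
  have tent_jb: "tent b (real M * p * ((real j + b) / p)) = tent b (real M * b)" for j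
  proof -
    have "real M * p * ((real j + b) / p) = of_int (int (M * j)) + real M * b"
      using p by (simp add: field_simps)
    then show ?thesis by (simp only: tent_of_int_add)
  qed
  have piece: "((\<lambda>x. f x * g x) has_integral c) {real j / p..real (Suc j) / p}" for j
  proof -
    have le: "real j / p \<le> (real j + b) / p" "(real j + b) / p \<le> real (Suc j) / p"
      using b p by (auto intro!: divide_right_mono)
    have fr: "frac (p * x) = p * x - real j" if "real j / p \<le> x" "x < real (Suc j) / p" for x
    proof -
      have "\<lfloor>p * x\<rfloor> = int j" using that p by (intro floor_unique) (auto simp: field_simps)
      then show ?thesis by (simp add: frac_def)
    qed
    have "((\<lambda>x. (1 - b) * g x) has_integral
        (1 - b) * ((tent b (real M * p * ((real j + b) / p)) - tent b (real M * p * (real j / p))) / (real M * p)))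
        {real j / p..(real j + b) / p}"
      by (intro has_integral_mult_right int_g le)
    then have 1: "((\<lambda>x. (1 - b) * g x) has_integral (1 - b) * c) {real j / p..(real j + b) / p}"
      unfolding tent_j tent_jb c_def by simp
    have 1: "((\<lambda>x. f x * g x) has_integral (1 - b) * c) {real j / p..(real j + b) / p}"
    \<comment> \<open>The factor \<open>f\<close> has its constant value on the half-open piece
      only, so the right endpoint is excepted.\<close>
    proof (rule has_integral_spike_finite[OF _ _ 1])
      fix x assume x: "x \<in> {real j / p..(real j + b) / p} - {(real j + b) / p}"
      then have "frac (p * x) = p * x - real j" using le by (intro fr) auto
      moreover have "p * x < real j + b" using x p by (auto simp: field_simps)
      ultimately show "f x * g x = (1 - b) * g x" by (simp add: f_def interval_dev_def)
    qed simp
    have "((\<lambda>x. - b * g x) has_integral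
        - b * ((tent b (real M * p * (real (Suc j) / p)) - tent b (real M * p * ((real j + b) / p))) / (real M * p)))
        {(real j + b) / p..real (Suc j) / p}"
      by (intro has_integral_mult_right int_g le)
    then have 2: "((\<lambda>x. - b * g x) has_integral b * c) {(real j + b) / p..real (Suc j) / p}"
      unfolding tent_j tent_jb c_def by simp
    have 2: "((\<lambda>x. f x * g x) has_integral b * c) {(real j + b) / p..real (Suc j) / p}"
    proof (rule has_integral_spike_finite[OF _ _ 2])
      fix x assume x: "x \<in> {(real j + b) / p..real (Suc j) / p} - {real (Suc j) / p}"
      then have "frac (p * x) = p * x - real j" using le by (intro fr) auto
      moreover have "real j + b \<le> p * x" using x p by (auto simp: field_simps)
      ultimately show "f x * g x = - b * g x" by (simp add: f_def interval_dev_def)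
    qed simp
    \<comment> \<open>The two pieces of a period together give \<open>c\<close>; the
      \<open>P\<close> periods in \<open>[0,1]\<close> then give \<open>P * c\<close>.\<close>
    have "(1 - b) * c + b * c = c" by (simp add: algebra_simps)
    then show ?thesis using has_integral_combine[OF le 1 2] by simp
  qed
  have "((\<lambda>x. f x * g x) has_integral real n * c) {0..real n / p}" for n
  proof (induction n)
    case (Suc n)
    have "((\<lambda>x. f x * g x) has_integral real n * c + c) {0..real (Suc n) / p}"
      by (rule has_integral_combine[OF _ _ Suc piece]) (use p in \<open>auto intro!: divide_right_mono\<close>)
    then show ?case by (simp add: algebra_simps)
  qed (simp add: has_integral_refl)
  from this[of P] show ?thesis
    using p M0 by (simp add: f_def g_def c_def p_def mult.assoc)
qed

section \<open>Correlations and variance\<close>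

text \<open>The quotient \<open>M\<close> of the two products is at least
  \<open>2 ^ (m - n)\<close>, and the exact correlation is a value of \<open>tent b\<close>, at most
  1, divided by \<open>M\<close>.\<close>

lemma correlation_bound:
  assumes q: "basic_sequence q" and b: "0 \<le> b" "b \<le> 1" and "n \<le> m"
  shows "\<exists>c \<le> (1/2) ^ (m - n). ((\<lambda>x. interval_dev b (real (cantor_base q n) * x) *
      interval_dev b (real (cantor_base q m) * x)) has_integral c) {0..1}"
proof -
  obtain M where M: "cantor_base q m = cantor_base q n * M"
    using cantor_base_dvd[OF \<open>n \<le> m\<close>] by blast
  have P: "cantor_base q n > 0" by (rule cantor_base_pos[OF q])
  have "2 ^ (m - n) * cantor_base q n \<le> M * cantor_base q n"
    using cantor_base_ge[OF q, of "m - n" n] \<open>n \<le> m\<close> M by (simp add: mult.commute)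
  then have "2 ^ (m - n) \<le> M" using P by simp
  then have ge: "(2::real) ^ (m - n) \<le> real M" by (metis of_nat_le_iff of_nat_numeral of_nat_power)
  then have M0: "real M > 0" by (smt (verit) zero_less_power)
  have "tent b (real M * b) / real M \<le> 1 / real M"
    using tent_le_1[OF b] by (intro divide_right_mono) auto
  also have "\<dots> \<le> 1 / 2 ^ (m - n)" using ge by (intro divide_left_mono) (use M0 in auto)
  finally have "tent b (real M * b) / real M \<le> (1/2) ^ (m - n)" by (simp add: power_one_over)
  then show ?thesis
    using has_integral_interval_dev_correlation[OF b P, of M] M0 M
    by (auto simp: mult.commute)
qed

lemma sum_half_power_le_1: "(\<Sum>n<N. (1/2::real) ^ (N - n)) \<le> 1"
proof -
  have "(\<Sum>n<N. (1/2::real) ^ (N - n)) = 1 - (1/2) ^ N"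
  proof (induction N)
    case (Suc N)
    have "(\<Sum>n<N. (1/2::real) ^ (Suc N - n)) = (\<Sum>n<N. 1/2 * (1/2) ^ (N - n))"
      by (intro sum.cong) (auto simp: Suc_diff_le)
    also have "\<dots> = 1/2 * (1 - (1/2) ^ N)" by (simp only: sum_distrib_left[symmetric] Suc)
    finally show ?case by simp
  qed simp
  then show ?thesis by simp
qed

text \<open>Appending the term with index \<open>N\<close> to the sum adds its own square, of
  integral at most 1, and twice its correlations with the earlier terms, which sum to at most 1 as a
  geometric series.\<close>

lemma variance_bound:
  assumes q: "basic_sequence q" and b: "0 \<le> b" "b \<le> 1"
  shows "\<exists>c \<le> 3 * real N. ((\<lambda>x. (\<Sum>n<N. interval_dev b (real (cantor_base q n) * x))\<^sup>2)
    has_integral c) {0..1}"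
proof (induction N)
  case 0
  show ?case by (intro exI[of _ 0]) simp
next
  case (Suc N)
  define e where "e n x = interval_dev b (real (cantor_base q n) * x)" for n x
  obtain c where c: "c \<le> 3 * real N" "((\<lambda>x. (\<Sum>n<N. e n x)\<^sup>2) has_integral c) {0..1}"
    using Suc unfolding e_def by blast
  have "\<forall>n\<in>{..N}. \<exists>d. d \<le> (1/2) ^ (N - n) \<and> ((\<lambda>x. e n x * e N x) has_integral d) {0..1}"
    using correlation_bound[OF q b] unfolding e_def by auto
  then obtain d where d: "\<And>n. n \<le> N \<Longrightarrow> d n \<le> (1/2) ^ (N - n)"
      "\<And>n. n \<le> N \<Longrightarrow> ((\<lambda>x. e n x * e N x) has_integral d n) {0..1}"
    unfolding Ball_def atMost_iff by metis
  have "((\<lambda>x. (\<Sum>n<N. e n x)\<^sup>2 + 2 * (\<Sum>n<N. e n x * e N x) + e N x * e N x)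
      has_integral c + 2 * (\<Sum>n<N. d n) + d N) {0..1}"
    by (intro has_integral_add has_integral_mult_right has_integral_sum c d) auto
  moreover have "(\<Sum>n<N. e n x)\<^sup>2 + 2 * (\<Sum>n<N. e n x * e N x) + e N x * e N x = (\<Sum>n<Suc N. e n x)\<^sup>2" for x
    by (simp add: power2_eq_square algebra_simps sum_distrib_left sum_distrib_right)
  moreover have "(\<Sum>n<N. d n) \<le> 1"
    using sum_mono[of "{..<N}" d "\<lambda>n. (1/2) ^ (N - n)"] d(1) sum_half_power_le_1[of N] by force
  moreover have "d N \<le> 1" using d(1)[of N] by simp
  ultimately show ?case using c(1) unfolding e_def
    by (intro exI[of _ "c + 2 * (\<Sum>n<N. d n) + d N"]) (auto simp: algebra_simps)
qed

lemma measurable_interval_dev [measurable]: "interval_dev b \<in> borel_measurable borel"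
  unfolding interval_dev_def frac_def by measurable

section \<open>Convergence of averages almost everywhere\<close>

text \<open>The average over \<open>K\<close> terms has second moment at most \<open>3 / K\<close>,
  which is summable along squares. Hence the sum of the squared averages is finite almost
  everywhere, and its terms tend to 0.\<close>

lemma AE_dev_average_squares_tendsto_0:
  assumes q: "basic_sequence q" and b: "0 \<le> b" "b \<le> 1"
  shows "AE x in lborel. x \<in> {0..1} \<longrightarrow>
    (\<lambda>k. (\<Sum>n<k\<^sup>2. interval_dev b (real (cantor_base q n) * x)) / real (k\<^sup>2)) \<longlonglongrightarrow> 0"
proof -
  \<comment> \<open>Starting at \<open>Suc k\<close> avoids division by 0;
    \<open>LIMSEQ_imp_Suc\<close> undoes the shift at the end.\<close>
  define A where "A k x = ((\<Sum>n<(Suc k)\<^sup>2. interval_dev b (real (cantor_base q n) * x)) / real ((Suc k)\<^sup>2))" for k x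
  define g where "g k x = ennreal ((A k x)\<^sup>2) * indicator {0..1} x" for k x
  have [measurable]: "g k \<in> borel_measurable lborel" for k
    unfolding g_def A_def by measurable
  have int: "(\<integral>\<^sup>+x. g k x \<partial>lborel) \<le> ennreal (3 * inverse (real (Suc k) ^ 2))" for k
  proof -
    define K where "K = real ((Suc k)\<^sup>2)"
    have K: "K > 0" by (simp add: K_def)
    obtain c where c: "c \<le> 3 * K" and
      int: "((\<lambda>x. (\<Sum>n<(Suc k)\<^sup>2. interval_dev b (real (cantor_base q n) * x))\<^sup>2) has_integral c) {0..1}"
      using variance_bound[OF q b, of "(Suc k)\<^sup>2"] unfolding K_def by blast
    have "((\<lambda>x. (A k x)\<^sup>2) has_integral c / K\<^sup>2) {0..1}"
      using has_integral_divide[OF int, of "K\<^sup>2"] unfolding A_def K_def[symmetric] power_divide .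
    then have "(\<integral>\<^sup>+x. g k x \<partial>lborel) = ennreal (c / K\<^sup>2)"
      unfolding g_def by (rule nn_integral_has_integral_lebesgue'[rotated]) simp
    also have "c / K\<^sup>2 \<le> 3 * K / K\<^sup>2" using c by (intro divide_right_mono) auto
    also have "\<dots> = 3 * inverse K" using K by (simp add: power2_eq_square divide_inverse)
    finally show ?thesis using ennreal_leI by (simp add: K_def)
  qed
  have "summable (\<lambda>k. inverse (real (Suc k) ^ 2))"
    using inverse_power_summable[of 2, where 'a = real]
    by (subst summable_Suc_iff[of "\<lambda>k. inverse (real k ^ 2)"]) simp
  then have sum: "summable (\<lambda>k. 3 * inverse (real (Suc k) ^ 2))" by (rule summable_mult)
  have "(\<integral>\<^sup>+x. (\<Sum>k. g k x) \<partial>lborel) = (\<Sum>k. \<integral>\<^sup>+x. g k x \<partial>lborel)"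
    by (rule nn_integral_suminf) simp
  also have "\<dots> \<le> (\<Sum>k. ennreal (3 * inverse (real (Suc k) ^ 2)))"
    by (intro suminf_le int) auto
  also have "\<dots> < \<infinity>"
    unfolding infinity_ennreal_def less_top[symmetric] by (rule ennreal_suminf_neq_top[OF sum]) simp
  finally have "AE x in lborel. (\<Sum>k. g k x) \<noteq> \<infinity>"
    by (intro nn_integral_PInf_AE) auto
  then show ?thesis
  proof eventually_elim
    case (elim x)
    show ?case
    proof
      assume "x \<in> {0..1}"
      then have "(\<Sum>k. ennreal ((A k x)\<^sup>2)) \<noteq> top" using elim by (simp add: g_def)
      then have "summable (\<lambda>k. (A k x)\<^sup>2)" by (intro summable_suminf_not_top) auto
      then have "(\<lambda>k. (A k x)\<^sup>2) \<longlonglongrightarrow> 0" by (rule summable_LIMSEQ_zero)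
      then have "(\<lambda>k. sqrt ((A k x)\<^sup>2)) \<longlonglongrightarrow> sqrt 0" by (rule tendsto_real_sqrt)
      then have "(\<lambda>k. A k x) \<longlonglongrightarrow> 0" by (simp add: tendsto_rabs_zero_iff)
      then show "(\<lambda>k. (\<Sum>n<k\<^sup>2. interval_dev b (real (cantor_base q n) * x)) / real (k\<^sup>2)) \<longlonglongrightarrow> 0"
        unfolding A_def by (rule LIMSEQ_imp_Suc)
    qed
  qed
qed

text \<open>For \<open>N\<close> between \<open>k^2\<close> and \<open>(k+1)^2\<close> the sum has
  moved by at most \<open>2 * k\<close> since \<open>k^2\<close>, which is negligible after division
  by \<open>k^2\<close>.\<close>

lemma average_tendsto_0_if_squares:
  fixes s :: "nat \<Rightarrow> real"
  assumes step: "\<And>n. \<bar>s (Suc n) - s n\<bar> \<le> 1"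
    and sq: "(\<lambda>k. s (k\<^sup>2) / real (k\<^sup>2)) \<longlonglongrightarrow> 0"
  shows "(\<lambda>N. s N / real N) \<longlonglongrightarrow> 0"
proof -
  have diff: "\<bar>s (m + j) - s m\<bar> \<le> real j" for m j
  proof (induction j)
    case (Suc j)
    then show ?case using step[of "m + j"] by simp
  qed simp
  have lim: "filterlim floor_sqrt at_top sequentially"
    unfolding filterlim_at_top
    by (auto simp: le_floor_sqrt_iff intro: eventually_ge_at_top)
  define h where "h k = \<bar>s (k\<^sup>2) / real (k\<^sup>2)\<bar> + 2 / real k" for k
  have "h \<longlonglongrightarrow> \<bar>0\<bar> + 0"
    unfolding h_def by (intro tendsto_add tendsto_rabs sq lim_const_over_n)
  then have "(\<lambda>N. h (floor_sqrt N)) \<longlonglongrightarrow> 0"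
    using lim by (auto intro: filterlim_compose)
  moreover have "\<forall>\<^sub>F N in sequentially. norm (s N / real N) \<le> h (floor_sqrt N)"
    using eventually_gt_at_top[of 0]
  proof eventually_elim
    case (elim N)
    define k where "k = floor_sqrt N"
    have k: "k > 0" using elim by (simp add: k_def)
    have le: "k\<^sup>2 \<le> N" by (simp add: k_def)
    have "N < (Suc k)\<^sup>2" unfolding k_def by (rule Suc_floor_sqrt_power2_gt)
    then have "real (N - k\<^sup>2) \<le> 2 * real k" by (simp add: power2_eq_square)
    then have "\<bar>s N\<bar> \<le> \<bar>s (k\<^sup>2)\<bar> + 2 * real k" using diff[of "k\<^sup>2" "N - k\<^sup>2"] le by simp
    then have "\<bar>s N\<bar> / real N \<le> (\<bar>s (k\<^sup>2)\<bar> + 2 * real k) / real N" by (rule divide_right_mono) simp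
    also have "\<dots> \<le> (\<bar>s (k\<^sup>2)\<bar> + 2 * real k) / real (k\<^sup>2)"
      using le k elim by (intro divide_left_mono) (auto simp del: of_nat_power)
    also have "\<dots> = h k" using k by (simp add: h_def add_divide_distrib power2_eq_square)
    finally show ?case by (simp add: k_def)
  qed
  ultimately show ?thesis by (rule Lim_null_comparison[rotated])
qed

section \<open>Uniform distribution from countably many conditions\<close>

text \<open>Counts are monotone in the endpoint \<open>b\<close>, so rational endpoints squeeze the
  real ones. Countability allows the exceptional null sets to be united.\<close>

lemma uniformly_distributed_if_rational:
  fixes u :: "nat \<Rightarrow> real"
  assumes rat: "\<And>b. b \<in> \<rat> \<Longrightarrow> 0 \<le> b \<Longrightarrow> b \<le> 1 \<Longrightarrow>
    (\<lambda>N. (\<Sum>n<N. interval_dev b (u n)) / real N) \<longlonglongrightarrow> 0"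
  shows "uniformly_distributed_mod_1 u"
proof -
  define C where "C b N = card {n. n < N \<and> frac (u n) < b}" for b N
  have fin: "finite {n. n < N \<and> frac (u n) < b}" for b N by simp
  have mono: "real (C b N) / real N \<le> real (C b' N) / real N" if "b \<le> b'" for b b' N
    unfolding C_def using that by (intro divide_right_mono of_nat_mono card_mono) auto
  have C_le: "real (C b N) / real N \<le> 1" for b N
  proof -
    have "C b N \<le> card {..<N}" unfolding C_def by (intro card_mono) auto
    then show ?thesis by (cases "N = 0") (auto simp: divide_le_eq_1)
  qed
  have rat': "(\<lambda>N. real (C b N) / real N) \<longlonglongrightarrow> b" if b: "b \<in> \<rat>" "0 \<le> b" "b \<le> 1" for b
  proof -
    have "(\<Sum>n<N. interval_dev b (u n)) = real (C b N) - b * real N" for N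
    proof -
      have "(\<Sum>n<N. if frac (u n) < b then 1 else 0::real) = real (card ({..<N} \<inter> {n. frac (u n) < b}))"
        by (simp add: sum.If_cases)
      also have "{..<N} \<inter> {n. frac (u n) < b} = {n. n < N \<and> frac (u n) < b}" by auto
      finally show ?thesis by (simp add: interval_dev_def sum_subtractf C_def)
    qed
    then have "(\<lambda>N. (real (C b N) - b * real N) / real N + b) \<longlonglongrightarrow> 0 + b"
      using rat[OF b] by (intro tendsto_add tendsto_const) simp
    moreover have "\<forall>\<^sub>F N in sequentially. (real (C b N) - b * real N) / real N + b = real (C b N) / real N"
      using eventually_gt_at_top[of 0] by eventually_elim (simp add: diff_divide_distrib)
    ultimately show ?thesis using Lim_transform_eventually by fastforce
  qed
  have lim: "(\<lambda>N. real (C b N) / real N) \<longlonglongrightarrow> b" if b: "0 \<le> b" "b \<le> 1" for b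
  proof (rule order_tendstoI)
    fix a assume a: "a < b"
    show "\<forall>\<^sub>F N in sequentially. a < real (C b N) / real N"
    \<comment> \<open>For negative \<open>a\<close> a rational between \<open>a\<close> and
      \<open>b\<close> may lie outside \<open>[0,1]\<close>, where \<open>rat'\<close> says nothing;
      there nonnegativity of the quotient suffices. The case \<open>1 < a\<close> below is its
      mirror image.\<close>
    proof (cases "a < 0")
      case True
      then show ?thesis by (intro always_eventually allI) (rule less_le_trans[of _ 0], auto)
    next
      case False
      obtain r where r: "r \<in> \<rat>" "a < r" "r < b" using Rats_dense_in_real[OF a] by blast
      have "\<forall>\<^sub>F N in sequentially. a < real (C r N) / real N"
        using order_tendstoD(1)[OF rat'] r False b by auto
      then show ?thesis
        by eventually_elim (use mono[of r b] r in \<open>auto intro: less_le_trans\<close>)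
    qed
  next
    fix a assume a: "b < a"
    show "\<forall>\<^sub>F N in sequentially. real (C b N) / real N < a"
    proof (cases "1 < a")
      case True
      then show ?thesis using C_le by (intro always_eventually allI) (rule le_less_trans[of _ 1], auto)
    next
      case False
      obtain r where r: "r \<in> \<rat>" "b < r" "r < a" using Rats_dense_in_real[OF a] by blast
      have "\<forall>\<^sub>F N in sequentially. real (C r N) / real N < a"
        using order_tendstoD(2)[OF rat'] r False b by auto
      then show ?thesis
        by eventually_elim (use mono[of b r] r in \<open>auto intro: le_less_trans\<close>)
    qed
  qed
  show ?thesis
    unfolding uniformly_distributed_mod_1_def
  proof (intro allI impI)
    fix a b :: real assume ab: "0 \<le> a \<and> a < b \<and> b \<le> 1"
    have "real (card {n. n < N \<and> frac (u n) \<in> {a..<b}}) = real (C b N) - real (C a N)" for N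
    proof -
      have "{n. n < N \<and> frac (u n) \<in> {a..<b}} =
          {n. n < N \<and> frac (u n) < b} - {n. n < N \<and> frac (u n) < a}" by auto
      moreover have "{n. n < N \<and> frac (u n) < a} \<subseteq> {n. n < N \<and> frac (u n) < b}" using ab by auto
      ultimately show ?thesis
        unfolding C_def using card_Diff_subset[OF fin] card_mono[OF fin] by (simp add: of_nat_diff)
    qed
    then show "(\<lambda>N. real (card {n. n < N \<and> frac (u n) \<in> {a..<b}}) / real N) \<longlonglongrightarrow> b - a"
      using tendsto_diff[OF lim lim, of b a] ab by (simp add: diff_divide_distrib)
  qed
qed

lemma DN_nonempty:
  assumes q: "basic_sequence q"
  shows "DN q \<noteq> {}"
proof -
  define good where "good x b \<longleftrightarrow>
    (\<lambda>k. (\<Sum>n<k\<^sup>2. interval_dev b (real (cantor_base q n) * x)) / real (k\<^sup>2)) \<longlonglongrightarrow> 0" for x b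
  have AE: "AE x in lborel. \<forall>b \<in> \<rat> \<inter> {0..1}. x \<in> {0..1} \<longrightarrow> good x b"
    using AE_dev_average_squares_tendsto_0[OF q] unfolding good_def
    by (subst AE_ball_countable) (auto intro: countable_rat)
  have "\<exists>x. \<forall>b \<in> \<rat> \<inter> {0..1}. good x b"
  proof (rule ccontr)
    assume none: "\<nexists>x. \<forall>b \<in> \<rat> \<inter> {0..1}. good x b"
    \<comment> \<open>Without a good point almost every real would lie outside \<open>[0,1]\<close>,
      a set of measure 1.\<close>
    have "AE x in lborel. x \<notin> {0..1::real}"
      using AE by eventually_elim (use none in blast)
    then show False using AE_iff_null_sets[of "{0..1::real}" lborel] by (auto simp: null_sets_def)
  qed
  then obtain x where x: "\<And>b. b \<in> \<rat> \<Longrightarrow> 0 \<le> b \<Longrightarrow> b \<le> 1 \<Longrightarrow> good x b"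
    by fastforce
  have "uniformly_distributed_mod_1 (\<lambda>n. real (cantor_base q n) * x)"
  proof (rule uniformly_distributed_if_rational)
    fix b :: real assume b: "b \<in> \<rat>" "0 \<le> b" "b \<le> 1"
    show "(\<lambda>N. (\<Sum>n<N. interval_dev b (real (cantor_base q n) * x)) / real N) \<longlonglongrightarrow> 0"
      by (rule average_tendsto_0_if_squares[OF _ x[OF b, unfolded good_def]]) (use b in \<open>auto simp: interval_dev_def\<close>)
  qed
  then show ?thesis using DN_iff by blast
qed

section \<open>Strategies in Schmidt's game\<close>

text \<open>Stated for an arbitrary ratio so that it fits either player. The condition on
  \<open>m\<close> says that the spacing \<open>1/P\<^sub>m\<close> is at least twice the length of
  \<open>I\<close>.\<close>

definition avoiding_move :: "(nat \<Rightarrow> nat) \<Rightarrow> real \<Rightarrow> ivl \<Rightarrow> ivl \<Rightarrow> bool" where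
  "avoiding_move q \<gamma> I J \<longleftrightarrow> legal_move \<gamma> I J \<and>
     (\<forall>m (j::int). \<forall>x\<in>ivl_set J. 4 * radius I * real (cantor_base q m) \<le> 1 \<longrightarrow>
        (1 - 2 * \<gamma>) * radius I \<le> \<bar>x - of_int j / real (cantor_base q m)\<bar>)"

lemma avoiding_move_exists:
  assumes q: "basic_sequence q" and \<gamma>: "0 < \<gamma>" "\<gamma> < 1/2" and pos: "radius I > 0"
  shows "\<exists>J. avoiding_move q \<gamma> I J"
proof -
  define \<rho> where "\<rho> = radius I"
  define c where "c = (fst I + snd I) / 2"
  define L where "L = (fst I, fst I + 2 * \<gamma> * \<rho>)"
  define R where "R = (snd I - 2 * \<gamma> * \<rho>, snd I)"
  have \<rho>: "\<rho> > 0" using pos by (simp add: \<rho>_def)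
  have ends: "fst I = c - \<rho>" "snd I = c + \<rho>"
    by (simp_all add: c_def \<rho>_def radius_def field_simps)
  have g\<rho>: "0 < \<gamma> * \<rho>" "2 * (\<gamma> * \<rho>) < \<rho>" using \<gamma> \<rho> by auto
  have legal: "legal_move \<gamma> I L" "legal_move \<gamma> I R"
    using g\<rho> \<gamma> unfolding legal_move_def \<rho>_def[symmetric]
    by (auto simp: L_def R_def ivl_set_def radius_def ends)
  define M where "M = {m. 4 * \<rho> * real (cantor_base q m) \<le> 1}"
  have fin: "finite M" unfolding M_def using finite_cantor_base_le[OF q] \<rho> by simp
  show ?thesis
  \<comment> \<open>If no scale is coarse enough, the distance condition is vacuous and either end
    will do.\<close>
  proof (cases "M = {}")
    case True
    then show ?thesis using legal unfolding avoiding_move_def M_def \<rho>_def by blast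
  next
    case False
    define n where "n = Max M"
    define p where "p = real (cantor_base q n)"
    \<comment> \<open>\<open>j / p\<close> is the multiple nearest to the centre \<open>c\<close>;
      the move goes to the opposite end, leaving a gap of \<open>(1 - 2 * \<gamma>) * \<rho>\<close>
      to \<open>c\<close>.\<close>
    define j where "j = round (c * p)"
    define J where "J = (if of_int j / p \<ge> c then L else R)"
    have n: "n \<in> M" using fin False by (simp add: n_def)
    have p0: "p > 0" using cantor_base_pos[OF q] by (simp add: p_def)
    have p: "4 * \<rho> * p \<le> 1" using n by (simp add: M_def p_def)
    have J_sub: "\<bar>x - c\<bar> \<le> \<rho>" if "x \<in> ivl_set J" for x
      using that g\<rho> by (auto simp: J_def L_def R_def ivl_set_def ends split: if_splits)
    have main: "(1 - 2 * \<gamma>) * \<rho> \<le> \<bar>x - of_int i / p\<bar>" if x: "x \<in> ivl_set J" for x i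
    proof (cases "i = j")
      case True
      then show ?thesis using x g\<rho>
        by (auto simp: J_def L_def R_def ivl_set_def ends algebra_simps split: if_splits)
    next
      case False
      have "\<bar>of_int j - c * p\<bar> \<le> 1/2" unfolding j_def by (rule of_int_round_abs_le)
      moreover have "\<bar>real_of_int i - of_int j\<bar> \<ge> 1" using False by linarith
      ultimately have "1/2 \<le> \<bar>of_int i - c * p\<bar>" by linarith
      \<comment> \<open>Any other multiple is at least half a spacing, hence
        \<open>2 * \<rho>\<close>, away from \<open>c\<close>, and so at least \<open>\<rho>\<close>
        away from the whole interval.\<close>
      then have "2 * \<rho> * p \<le> \<bar>of_int i - c * p\<bar>" using p by linarith
      also have "of_int i - c * p = (of_int i / p - c) * p" using p0 by (simp add: left_diff_distrib)
      also have "\<bar>(of_int i / p - c) * p\<bar> = \<bar>of_int i / p - c\<bar> * p"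
        using p0 by (simp only: abs_mult abs_of_pos)
      finally have "2 * \<rho> \<le> \<bar>of_int i / p - c\<bar>" using p0 by simp
      then have "\<rho> \<le> \<bar>x - of_int i / p\<bar>" using J_sub[OF x] by linarith
      then show ?thesis using g\<rho> by (simp add: algebra_simps)
    qed
    have "(1 - 2 * \<gamma>) * \<rho> \<le> \<bar>x - of_int i / real (cantor_base q m)\<bar>"
      if x: "x \<in> ivl_set J" and m: "4 * \<rho> * real (cantor_base q m) \<le> 1" for x m and i :: int
    proof -
      have "m \<le> n" using m fin by (simp add: n_def M_def)
      then obtain d where d: "cantor_base q n = cantor_base q m * d"
        using cantor_base_dvd by blast
      then have "d > 0" using cantor_base_pos[OF q, of n] by (cases d) auto
      then have "of_int i / real (cantor_base q m) = of_int (i * int d) / p"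
        by (simp add: p_def d)
      then show ?thesis using main[OF x] by metis
    qed
    moreover have "legal_move \<gamma> I J" using legal by (simp add: J_def)
    ultimately show ?thesis unfolding avoiding_move_def \<rho>_def by blast
  qed
qed

text \<open>All but finitely many orbit points stay out of some \<open>[0,\<delta>)\<close>, so
  their frequency there tends to 0 instead of \<open>\<delta>\<close>.\<close>

lemma avoiding_moves_imp_not_DN:
  assumes q: "basic_sequence q" and \<gamma>: "\<gamma> < 1/2" and r: "r > 0" and c: "0 < c" "c < 1"
    and move: "\<And>k. avoiding_move q \<gamma> (I k) (J k)"
    and rad: "\<And>k. radius (I k) = r * c ^ k"
    and x: "\<And>k. x \<in> ivl_set (J k)"
  shows "x \<notin> DN q"
proof
  assume "x \<in> DN q"
  \<comment> \<open>In the first round \<open>k\<close> fine enough for \<open>p\<close>,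
    \<open>r * c ^ k * p\<close> is above \<open>c / 4\<close>; the factor
    \<open>1 - 2 * \<gamma>\<close> is the guaranteed relative gap.\<close>
  define \<epsilon> where "\<epsilon> = (1 - 2 * \<gamma>) * c / 4"
  define \<delta> where "\<delta> = min \<epsilon> 1"
  have \<epsilon>: "\<epsilon> > 0" using \<gamma> c by (simp add: \<epsilon>_def)
  then have \<delta>: "0 < \<delta>" "\<delta> \<le> 1" "\<delta> \<le> \<epsilon>" by (auto simp: \<delta>_def)
  define K where "K = {n. (4 * r) * real (cantor_base q n) \<le> 1}"
  have fin: "finite K" unfolding K_def using finite_cantor_base_le[OF q] r by simp
  have "\<epsilon> \<le> frac (real (cantor_base q n) * x)" if n: "n \<notin> K" for n
  proof -
    define p where "p = real (cantor_base q n)"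
    have p: "p > 0" using cantor_base_pos[OF q] by (simp add: p_def)
    obtain k where k: "4 * (r * c ^ k) * p \<le> 1" and "\<And>i. i < k \<Longrightarrow> \<not> 4 * (r * c ^ i) * p \<le> 1"
    proof -
      obtain k where "c ^ k < 1 / (4 * r * p)"
        using real_arch_pow_inv[of "1 / (4 * r * p)" c] c r p by auto
      then have "4 * (r * c ^ k) * p \<le> 1" using r p by (simp add: field_simps)
      then show ?thesis using that exists_least_iff[of "\<lambda>k. 4 * (r * c ^ k) * p \<le> 1"] by blast
    qed
    \<comment> \<open>As \<open>n\<close> is outside \<open>K\<close>, round 0 is too coarse, so
      round \<open>k - 1\<close> exists and violates the inequality.\<close>
    moreover have "k \<noteq> 0" using k n by (auto simp: K_def p_def intro!: Nat.gr0I)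
    ultimately have "1 < 4 * (r * c ^ (k - 1)) * p" by (metis diff_less less_one not_le not_gr_zero)
    then have "c * 1 < c * (4 * (r * c ^ (k - 1)) * p)" using c by (intro mult_strict_left_mono)
    also have "\<dots> = 4 * (r * c ^ k) * p" using \<open>k \<noteq> 0\<close> by (cases k) auto
    finally have "c / 4 \<le> r * c ^ k * p" by simp
    then have "(1 - 2 * \<gamma>) * (c / 4) \<le> (1 - 2 * \<gamma>) * (r * c ^ k * p)"
      using \<gamma> by (intro mult_left_mono) auto
    then have "\<epsilon> \<le> (1 - 2 * \<gamma>) * (r * c ^ k) * p" by (simp add: \<epsilon>_def mult.assoc)
    also have "\<dots> \<le> \<bar>x - of_int \<lfloor>p * x\<rfloor> / p\<bar> * p"
      using move[of k] x[of k] k p unfolding avoiding_move_def rad p_def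
      by (intro mult_right_mono) auto
    also have "\<dots> = \<bar>(x - of_int \<lfloor>p * x\<rfloor> / p) * p\<bar>" using p by (simp only: abs_mult abs_of_pos)
    also have "(x - of_int \<lfloor>p * x\<rfloor> / p) * p = p * x - of_int \<lfloor>p * x\<rfloor>"
      using p by (simp add: left_diff_distrib)
    also have "\<bar>p * x - of_int \<lfloor>p * x\<rfloor>\<bar> = frac (p * x)" by (simp add: frac_def)
    finally show ?thesis by (simp add: p_def)
  qed
  then have sub: "{n. n < N \<and> frac (real (cantor_base q n) * x) \<in> {0..<\<delta>}} \<subseteq> K" for N
    using \<delta> by force
  have "(\<lambda>N. real (card {n. n < N \<and> frac (real (cantor_base q n) * x) \<in> {0..<\<delta>}}) / real N)
      \<longlonglongrightarrow> 0"
  proof (rule tendsto_sandwich[of "\<lambda>_. 0" _ _ "\<lambda>N. real (card K) / real N"])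
    show "(\<lambda>N. real (card K) / real N) \<longlonglongrightarrow> 0" by (rule lim_const_over_n)
    show "\<forall>\<^sub>F N in sequentially.
        real (card {n. n < N \<and> frac (real (cantor_base q n) * x) \<in> {0..<\<delta>}}) / real N
        \<le> real (card K) / real N"
      using card_mono[OF fin sub] by (intro always_eventually allI divide_right_mono) auto
  qed auto
  moreover have "(\<lambda>N. real (card {n. n < N \<and> frac (real (cantor_base q n) * x) \<in> {0..<\<delta>}}) / real N)
      \<longlonglongrightarrow> \<delta> - 0"
    using \<open>x \<in> DN q\<close> \<delta> unfolding DN_iff uniformly_distributed_mod_1_def by blast
  ultimately show False using LIMSEQ_unique \<delta>(1) by force
qed

section \<open>Outcomes of the game\<close>

lemma radius_pos_imp_le: "radius I > 0 \<Longrightarrow> fst I \<le> snd I"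
  by (simp add: radius_def)

lemma winning_complement_DN:
  assumes q: "basic_sequence q" and \<alpha>: "0 < \<alpha>" "\<alpha> < 1/2"
  shows "winning \<alpha> (UNIV - DN q)"
  unfolding winning_def winning2_def
proof (intro allI impI)
  fix \<beta> :: real assume \<beta>: "0 < \<beta> \<and> \<beta> < 1"
  \<comment> \<open>Alice looks only at Bob's latest interval; in legal play its radius is positive,
    so the choice is meaningful.\<close>
  define \<sigma> where "\<sigma> Bs = (SOME J. avoiding_move q \<alpha> (last Bs) J)" for Bs
  have reply: "reply \<sigma> B n = (SOME J. avoiding_move q \<alpha> (B n) J)" for B n
    by (simp add: reply_def \<sigma>_def)
  have ok: "avoiding_move q \<alpha> (B n) (reply \<sigma> B n)" if "radius (B n) > 0" for B n
    unfolding reply by (rule someI_ex) (rule avoiding_move_exists[OF q \<alpha> that])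
  have rad: "radius (B n) = radius (B 0) * (\<alpha> * \<beta>) ^ n" if "bob_legal_upto \<beta> \<sigma> B n" for B n
    using that
  proof (induction n)
    case (Suc n)
    have IH: "radius (B n) = radius (B 0) * (\<alpha> * \<beta>) ^ n"
      and pos: "radius (B 0) > 0" and "legal_move \<beta> (reply \<sigma> B n) (B (Suc n))"
      using Suc by (auto simp: bob_legal_upto_def)
    moreover have "legal_move \<alpha> (B n) (reply \<sigma> B n)"
      using ok[of B n] pos \<alpha> \<beta> by (simp add: IH avoiding_move_def)
    ultimately show ?case by (simp add: legal_move_def)
  qed simp
  have pos: "radius (B n) > 0" if "bob_legal_upto \<beta> \<sigma> B n" for B n
    using rad[OF that] that \<alpha> \<beta> by (simp add: bob_legal_upto_def)
  have "winning_strategy \<alpha> \<beta> (UNIV - DN q) \<sigma>"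
    unfolding winning_strategy_def
  proof (intro allI conjI impI)
    fix B n assume "bob_legal_upto \<beta> \<sigma> B n"
    then show "legal_move \<alpha> (B n) (reply \<sigma> B n)"
      using ok pos by (simp add: avoiding_move_def)
  next
    fix B assume legal: "\<forall>n. bob_legal_upto \<beta> \<sigma> B n"
    have "x \<notin> DN q" if x: "x \<in> (\<Inter>n. ivl_set (B n))" for x
    proof (rule avoiding_moves_imp_not_DN[OF q \<alpha>(2)])
      show "radius (B 0) > 0" using legal pos by blast
      have "\<alpha> * \<beta> < 1 * 1" by (rule mult_strict_mono) (use \<alpha> \<beta> in auto)
      then show "0 < \<alpha> * \<beta>" "\<alpha> * \<beta> < 1" using \<alpha> \<beta> by auto
      show "avoiding_move q \<alpha> (B k) (reply \<sigma> B k)" for k using legal pos ok by blast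
      show "radius (B k) = radius (B 0) * (\<alpha> * \<beta>) ^ k" for k using legal rad by blast
      have "ivl_set (B (Suc k)) \<subseteq> ivl_set (reply \<sigma> B k)" for k
        using legal by (auto simp: bob_legal_upto_def legal_move_def)
      then show "x \<in> ivl_set (reply \<sigma> B k)" for k using x by blast
    qed
    then show "(\<Inter>n. ivl_set (B n)) \<subseteq> UNIV - DN q" by blast
  qed
  then show "\<exists>\<sigma>. winning_strategy \<alpha> \<beta> (UNIV - DN q) \<sigma>" by blast
qed

text \<open>Bob plays the avoiding moves himself, treating Alice's replies as the intervals
  \<open>I k\<close>, and forces a point outside \<open>DN q\<close>.\<close>

lemma not_winning_subset_DN:
  assumes q: "basic_sequence q" and \<alpha>: "0 < \<alpha>" "\<alpha> < 1" and S: "S \<subseteq> DN q"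
  shows "\<not> winning \<alpha> S"
proof
  assume "winning \<alpha> S"
  define \<beta> :: real where "\<beta> = 1/4"
  have \<beta>: "0 < \<beta>" "\<beta> < 1/2" by (auto simp: \<beta>_def)
  obtain \<sigma> where \<sigma>: "winning_strategy \<alpha> \<beta> S \<sigma>"
    using \<open>winning \<alpha> S\<close> \<beta> unfolding winning_def winning2_def by force
  define D where "D I = (SOME J. avoiding_move q \<beta> I J)" for I
  have D: "avoiding_move q \<beta> I (D I)" if "radius I > 0" for I
    unfolding D_def by (rule someI_ex) (rule avoiding_move_exists[OF q \<beta> that])
  \<comment> \<open>Alice's strategy reads the whole history, so the recursion builds the list of
    Bob's moves and \<open>B\<close> picks out its last entries.\<close>
  define h :: "nat \<Rightarrow> ivl list" where "h = rec_nat [(0, 2)] (\<lambda>_ Bs. Bs @ [D (\<sigma> Bs)])"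
  define B where "B n = last (h n)" for n
  have h_Suc: "h (Suc n) = h n @ [D (\<sigma> (h n))]" for n by (simp add: h_def)
  have h: "h n = map B [0..<Suc n]" for n
  proof (induction n)
    case 0
    show ?case by (simp add: B_def h_def)
  next
    case (Suc n)
    have "B (Suc n) = D (\<sigma> (h n))" by (simp add: B_def h_Suc)
    then show ?case using Suc by (simp add: h_Suc)
  qed
  have B_Suc: "B (Suc n) = D (reply \<sigma> B n)" for n
    unfolding reply_def h[symmetric] by (simp add: B_def h_Suc)
  have B0: "radius (B 0) = 1" by (simp add: B_def h_def radius_def)
  \<comment> \<open>Alice's reply is known to be legal only after legal play, so legality and radii
    are established together.\<close>
  have inv: "bob_legal_upto \<beta> \<sigma> B n \<and> radius (B n) = (\<alpha> * \<beta>) ^ n" for n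
  proof (induction n)
    case (Suc n)
    then have "legal_move \<alpha> (B n) (reply \<sigma> B n)"
      using \<sigma> by (simp add: winning_strategy_def)
    then have rad: "radius (reply \<sigma> B n) = \<alpha> * (\<alpha> * \<beta>) ^ n"
      using Suc by (simp add: legal_move_def)
    then have "legal_move \<beta> (reply \<sigma> B n) (B (Suc n))"
      unfolding B_Suc using D[of "reply \<sigma> B n"] \<alpha> \<beta> by (simp add: avoiding_move_def)
    then show ?case using Suc rad by (auto simp: bob_legal_upto_def legal_move_def less_Suc_eq)
  qed (simp add: bob_legal_upto_def B0)
  have legal: "legal_move \<alpha> (B n) (reply \<sigma> B n)" for n
    using \<sigma> inv by (simp add: winning_strategy_def)
  then have rad: "radius (reply \<sigma> B n) = \<alpha> * (\<alpha> * \<beta>) ^ n" for n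
    using inv by (simp add: legal_move_def)
  have move: "avoiding_move q \<beta> (reply \<sigma> B n) (B (Suc n))" for n
    unfolding B_Suc by (rule D) (use rad \<alpha> \<beta> in simp)
  have dec: "ivl_set (B (Suc n)) \<subseteq> ivl_set (B n)" for n
    using legal[of n] move[of n] by (auto simp: legal_move_def avoiding_move_def)
  \<comment> \<open>An empty intersection would satisfy Alice's goal trivially, so compactness must
    supply a point.\<close>
  have "(\<Inter>n. ivl_set (B n)) \<noteq> {}"
  proof (rule compact_nest)
    show "compact (ivl_set (B n))" "ivl_set (B n) \<noteq> {}" for n
      using radius_pos_imp_le[of "B n"] inv[of n] \<alpha> \<beta> by (auto simp: ivl_set_def)
    show "ivl_set (B n) \<subseteq> ivl_set (B m)" if "m \<le> n" for m n
      using that dec by (rule lift_Suc_antimono_le[rotated])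
  qed
  then obtain x where x: "\<And>n. x \<in> ivl_set (B n)" by blast
  have "x \<notin> DN q"
  proof (rule avoiding_moves_imp_not_DN[OF q \<beta>(2) \<alpha>(1)])
    have "\<alpha> * \<beta> < 1 * 1" by (rule mult_strict_mono) (use \<alpha> \<beta> in auto)
    then show "0 < \<alpha> * \<beta>" "\<alpha> * \<beta> < 1" using \<alpha> \<beta> by auto
  qed (use move rad x in auto)
  moreover have "(\<Inter>n. ivl_set (B n)) \<subseteq> S"
    using \<sigma> inv unfolding winning_strategy_def by blast
  ultimately show False using x S by blast
qed

lemma winning_gt_half_imp_UNIV:
  assumes \<alpha>: "1/2 < \<alpha>" "\<alpha> < 1" and win: "winning \<alpha> S"
  shows "S = UNIV"
proof -
  have "x \<in> S" for x
  proof -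
    \<comment> \<open>Every reply to an interval of radius \<open>\<rho>\<close> centred at
      \<open>x\<close> reaches at least \<open>(2 * \<alpha> - 1) * \<rho>\<close> to both sides of
      \<open>x\<close>. This \<open>\<beta>\<close> makes Bob's next radius no larger than that, so
      he can centre at \<open>x\<close> again.\<close>
    define \<beta> where "\<beta> = 2 * \<alpha> - 1"
    have \<beta>: "0 < \<beta>" "\<beta> < 1" using \<alpha> by (auto simp: \<beta>_def)
    have ab: "\<alpha> * \<beta> \<le> 2 * \<alpha> - 1" unfolding \<beta>_def using \<alpha> by (simp add: mult_left_le_one_le)
    obtain \<sigma> where \<sigma>: "winning_strategy \<alpha> \<beta> S \<sigma>"
      using win \<beta> unfolding winning_def winning2_def by force
    define r where "r n = (\<alpha> * \<beta>) ^ n" for n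
    have r: "r n > 0" for n using \<alpha> \<beta> by (simp add: r_def)
    define B where "B n = (x - r n, x + r n)" for n
    have rad: "radius (B n) = r n" for n by (simp add: B_def radius_def)
    have inv: "bob_legal_upto \<beta> \<sigma> B n" for n
    proof (induction n)
      case (Suc n)
      then have legal: "legal_move \<alpha> (B n) (reply \<sigma> B n)"
        using \<sigma> by (simp add: winning_strategy_def)
      obtain u v where uv: "reply \<sigma> B n = (u, v)" by fastforce
      have len: "v - u = 2 * (\<alpha> * r n)"
        using legal unfolding legal_move_def rad by (simp add: radius_def uv)
      \<comment> \<open>Positive length makes the reply nonempty, so inclusion of the sets gives
        inequalities between the endpoints.\<close>
      have "\<alpha> * r n > 0" using \<alpha> r[of n] by simp
      then have ends: "x - r n \<le> u" "v \<le> x + r n"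
        using legal len by (auto simp: legal_move_def uv ivl_set_def B_def)
      have "r (Suc n) \<le> (2 * \<alpha> - 1) * r n"
        using mult_right_mono[OF ab, of "r n"] r[of n] by (simp add: r_def)
      then have "u \<le> x - r (Suc n)" "x + r (Suc n) \<le> v"
        using ends len by (auto simp: algebra_simps)
      then have "legal_move \<beta> (reply \<sigma> B n) (B (Suc n))"
        using len by (auto simp: legal_move_def uv ivl_set_def B_def radius_def r_def)
      then show ?case using Suc by (auto simp: bob_legal_upto_def less_Suc_eq)
    qed (simp add: bob_legal_upto_def rad r)
    have "(\<Inter>n. ivl_set (B n)) \<subseteq> S" using \<sigma> inv unfolding winning_strategy_def by blast
    moreover have "x \<in> ivl_set (B n)" for n using r[of n] by (simp add: B_def ivl_set_def)
    ultimately show "x \<in> S" by blast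
  qed
  then show ?thesis by blast
qed

theorem corollary2p2:
  fixes q :: "nat \<Rightarrow> nat"
  assumes "basic_sequence q"
  shows "windim (UNIV - DN q) = 1/2 \<and>
    (\<forall>\<alpha>. 0 < \<alpha> \<and> \<alpha> < 1 \<longrightarrow> \<not> winning \<alpha> (DN q - RN1 q))"
proof
  define W where "W = insert 0 {\<alpha>. 0 < \<alpha> \<and> \<alpha> < 1 \<and> winning \<alpha> (UNIV - DN q)}"
  \<comment> \<open>Winning with a larger ratio would force \<open>DN q\<close> to be empty.\<close>
  have upper: "\<alpha> \<le> 1/2" if "\<alpha> \<in> W" for \<alpha>
    using that winning_gt_half_imp_UNIV[of \<alpha> "UNIV - DN q"] DN_nonempty[OF assms]
    by (force simp: W_def)
  have lower: "{0<..<1/2} \<subseteq> W" using winning_complement_DN[OF assms] by (auto simp: W_def)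
  have "Sup W = 1/2"
  proof (rule antisym)
    show "Sup W \<le> 1/2" using upper by (intro cSup_least) (auto simp: W_def)
    have "Sup {0<..<1/2::real} \<le> Sup W"
      using lower upper by (intro cSup_subset_mono bdd_aboveI[of W "1/2"]) auto
    then show "1/2 \<le> Sup W" by simp
  qed
  then show "windim (UNIV - DN q) = 1/2" by (simp add: windim_def W_def)
  show "\<forall>\<alpha>. 0 < \<alpha> \<and> \<alpha> < 1 \<longrightarrow> \<not> winning \<alpha> (DN q - RN1 q)"
    using not_winning_subset_DN[OF assms] by blast
qed

end
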